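(* Let $F$ be a piecewise interval map (PIM) on $[0,1)$ (type A, type B or mixed type). If $F$ satisfies Parry topological transitivity (PTT), then $F$-representations are valid.
   Context: Let $\lambda$ be Lebesgue measure on $[0,1)$. An interval partition is a finite or countable indexed collection $\xi=\{\Delta(d)\subseteq[0,1):d\in\mathcal D\}$ of disjoint intervals, $2\le \#(\xi)\le\infty$, with $\lambda(D)=1$ where $D=\bigcup_{d\in\mathcal D}\Delta(d)$. Each $\Delta(d)$ has endpoints $a_d<b_d$ and may be open, closed, or half-open on either side. A piecewise interval map (PIM) $F$ on $[0,1)$ is an interval partition $\xi$ together with a map $F:D\to[0,1)$ such that: (1) each $F|_{\Delta(d)}$ is continuous and strictly monotonic; (2) $\lambda([0,1)\setminus B)=0$, where $B=\{x: F^n x\in D \text{ for all } n\ge 0\}$; (3) for all $n\ge1$ and $d_1,\dots,d_n\in\mathcal D$, the set $\Delta(d_1d_2\dots d_n)=\Delta(d_1)\cap F^{-1}\Delta(d_2)\cap\dots\cap F^{-n+1}\Delta(d_n)$ is either empty or an interval of positive length. $F$ is not required to be surjective. $F$ is type A if every $F|_{\Delta(d)}$ is increasing, type B if every $F|_{\Delta(d)}$ is decreasing, and mixed type otherwise. PTT: there is $x\in[0,1)$ such that the backward orbit $O^-(x)=\{y: F^n y \text{ is defined and } x=F^n y\text{ for some } n\ge 0\}$ is dense in $[0,1)$. For $x\in B$ the $F$-representation of $x$ is the sequence $\mathbf r(x)=.d_1d_2d_3\dots\in\mathcal D^{\mathbb N}$, where $d_n$ is the unique digit with $F^{n-1}x\in\Delta(d_n)$.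 $F$-representations are valid if the map $\mathbf r$ is injective for $\lambda$-a.e. $x\in B$, i.e. there is a $\lambda$-null set $N$ such that $\mathbf r$ is injective on $B\setminus N$. *)

theory Defs
  imports "HOL-Analysis.Analysis"
begin

definition nondegenerate_interval :: "real set \<Rightarrow> bool" where
  "nondegenerate_interval S \<longleftrightarrow>
     (\<exists>a b. a < b \<and> (S = {a..b} \<or> S = {a..<b} \<or> S = {a<..b} \<or> S = {a<..<b}))"

definition interval_partition :: "'d set \<Rightarrow> ('d \<Rightarrow> real set) \<Rightarrow> bool" where
  "interval_partition I \<Delta> \<longleftrightarrow>
     countable I \<and> (infinite I \<or> 2 \<le> card I) \<and>
     (\<forall>d\<in>I. nondegenerate_interval (\<Delta> d) \<and> \<Delta> d \<subseteq> {0..<1}) \<and>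
     disjoint_family_on \<Delta> I \<and>
     emeasure lebesgue (\<Union>d\<in>I. \<Delta> d) = 1"

text \<open>
  A partial map on \<open>[0,1)\<close> with domain \<open>D\<close> is rendered as a total function \<open>F\<close> whose values
  outside \<open>D\<close> are irrelevant; iterates are therefore only used at points where they are defined.
\<close>

definition iterate_defined :: "real set \<Rightarrow> (real \<Rightarrow> real) \<Rightarrow> nat \<Rightarrow> real \<Rightarrow> bool" where
  "iterate_defined D F n y \<longleftrightarrow> y \<in> {0..<1} \<and> (\<forall>k<n. (F ^^ k) y \<in> D)"

definition forward_domain :: "real set \<Rightarrow> (real \<Rightarrow> real) \<Rightarrow> real set" where
  "forward_domain D F = {x. \<forall>n. (F ^^ n) x \<in> D}"

text \<open>
  For a digit string \<open>d\<^sub>1 \<dots> d\<^sub>n\<close>, membership of \<open>F\<^sup>i x\<close> in \<open>\<Delta> d\<^sub>i\<^sub>+\<^sub>1\<close> for all \<open>i < n\<close>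
  already forces every iterate involved to be defined at \<open>x\<close>.
\<close>

definition cylinder :: "('d \<Rightarrow> real set) \<Rightarrow> (real \<Rightarrow> real) \<Rightarrow> 'd list \<Rightarrow> real set" where
  "cylinder \<Delta> F ds = {x. \<forall>i<length ds. (F ^^ i) x \<in> \<Delta> (ds ! i)}"

text \<open>
  The direction of monotonicity may depend on the digit, so maps that are increasing on all
  intervals (type A), decreasing on all intervals (type B), and of mixed type are all covered.
\<close>

definition piecewise_interval_map ::
    "'d set \<Rightarrow> ('d \<Rightarrow> real set) \<Rightarrow> (real \<Rightarrow> real) \<Rightarrow> bool" where
  "piecewise_interval_map I \<Delta> F \<longleftrightarrow>
     interval_partition I \<Delta> \<and>
     F ` (\<Union>d\<in>I. \<Delta> d) \<subseteq> {0..<1} \<and>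
     (\<forall>d\<in>I. continuous_on (\<Delta> d) F \<and>
             (strict_mono_on (\<Delta> d) F \<or> strict_antimono_on (\<Delta> d) F)) \<and>
     {0..<1} - forward_domain (\<Union>d\<in>I. \<Delta> d) F \<in> null_sets lebesgue \<and>
     (\<forall>ds. ds \<noteq> [] \<and> set ds \<subseteq> I \<longrightarrow>
             cylinder \<Delta> F ds = {} \<or> nondegenerate_interval (cylinder \<Delta> F ds))"

definition backward_orbit :: "real set \<Rightarrow> (real \<Rightarrow> real) \<Rightarrow> real \<Rightarrow> real set" where
  "backward_orbit D F x = {y. \<exists>n. iterate_defined D F n y \<and> x = (F ^^ n) y}"

definition parry_topologically_transitive :: "real set \<Rightarrow> (real \<Rightarrow> real) \<Rightarrow> bool" where
  "parry_topologically_transitive D F \<longleftrightarrow>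
     (\<exists>x\<in>{0..<1}. {0..<1} \<subseteq> closure (backward_orbit D F x))"

text \<open>Digit sequences are indexed from \<open>0\<close>: position \<open>n\<close> holds the digit \<open>d\<^sub>n\<^sub>+\<^sub>1\<close>.\<close>

definition F_representation ::
    "'d set \<Rightarrow> ('d \<Rightarrow> real set) \<Rightarrow> (real \<Rightarrow> real) \<Rightarrow> real \<Rightarrow> nat \<Rightarrow> 'd" where
  "F_representation I \<Delta> F x = (\<lambda>n. THE d. d \<in> I \<and> (F ^^ n) x \<in> \<Delta> d)"

definition valid_representations ::
    "'d set \<Rightarrow> ('d \<Rightarrow> real set) \<Rightarrow> (real \<Rightarrow> real) \<Rightarrow> bool" where
  "valid_representations I \<Delta> F \<longleftrightarrow>
     (\<exists>N\<in>null_sets lebesgue.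
        inj_on (F_representation I \<Delta> F) (forward_domain (\<Union>d\<in>I. \<Delta> d) F - N))"

end

theory Submission imports Defs begin

text \<open>
  If two points share their digit sequence, then the set of all points with this digit sequence is a
  nondegenerate interval \<open>J\<close>, on which every iterate of \<open>F\<close> is strictly monotone. A dense backward
  orbit of some \<open>z\<close> meets \<open>J\<close> at two different levels \<open>n < m\<close>, so \<open>z\<close> lies in the
  corresponding set of both shifted digit sequences; hence the shifted sequence is periodic, and some
  iterate \<open>G = F\<^sup>q\<close> maps its interval increasingly into itself. For each residue modulo
  \<open>q\<close>, the preimages of \<open>z\<close> in this interval form a monotone sequence, so the backward orbit is a
  finite union of nowhere dense sets there. No null set has to be removed.
\<close>

section \<open>Nowhere dense sets of reals\<close>

lemma finite_UN_nowhere_dense: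
  fixes S :: "'i \<Rightarrow> 'a::topological_space set"
  assumes "finite A" "\<And>i. i \<in> A \<Longrightarrow> interior (closure (S i)) = {}"
  shows "interior (closure (\<Union>i\<in>A. S i)) = {}"
  using assms
proof (induction A rule: finite_induct)
  case (insert i A)
  then show ?case
    by (simp add: closure_Un interior_closed_Un_empty_interior)
qed simp

text \<open>An open subset of the closure would contain some \<open>w\<close> in \<open>W\<close>,
  and \<open>W\<close> would be dense, hence infinite, in short intervals on both sides of
  \<open>w\<close>.\<close>

lemma nowhere_dense_if_finite_on_one_side:
  fixes W :: "real set"
  assumes "\<And>w. w \<in> W \<Longrightarrow> finite (W \<inter> {w<..}) \<or> finite (W \<inter> {..<w})"
  shows "interior (closure W) = {}"
proof (rule ccontr)
  let ?U = "interior (closure W)"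
  \<comment> \<open>A finite trace of \<open>W\<close> on the interval is closed, so density would
    make it the whole interval.\<close>
  have infinite_part: "infinite (W \<inter> {a<..<b})" if "a < b" "{a<..<b} \<subseteq> ?U" for a b
  proof
    assume "finite (W \<inter> {a<..<b})"
    then have "closure ({a<..<b} \<inter> W) = {a<..<b} \<inter> W"
      by (simp add: finite_imp_closed Int_commute)
    moreover have "{a<..<b} \<inter> closure W \<subseteq> closure ({a<..<b} \<inter> W)"
      by (rule open_Int_closure_subset) simp
    moreover have "{a<..<b} \<subseteq> closure W"
      using that interior_subset by blast
    ultimately have "{a<..<b} \<subseteq> W \<inter> {a<..<b}"
      by auto
    then show False
      using \<open>finite (W \<inter> {a<..<b})\<close> \<open>a < b\<close> by (meson finite_subset infinite_Ioo)
  qed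
  assume "?U \<noteq> {}"
  then have "?U \<inter> closure W \<noteq> {}"
    using interior_subset by blast
  then have "?U \<inter> W \<noteq> {}"
    by (simp add: open_Int_closure_eq_empty)
  then obtain w where w: "w \<in> ?U" "w \<in> W" by blast
  obtain e where e: "e > 0" "ball w e \<subseteq> ?U"
    using w(1) open_interior open_contains_ball by blast
  have "{w<..<w + e} \<subseteq> ?U" "{w - e<..<w} \<subseteq> ?U"
    using e by (auto simp: ball_eq_greaterThanLessThan)
  then have "infinite (W \<inter> {w<..<w + e})" "infinite (W \<inter> {w - e<..<w})"
    using e(1) infinite_part[of w "w + e"] infinite_part[of "w - e" w] by simp_all
  moreover have "W \<inter> {w<..<w + e} \<subseteq> W \<inter> {w<..}" "W \<inter> {w - e<..<w} \<subseteq> W \<inter> {..<w}"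
    by auto
  ultimately show False
    using assms[OF w(2)] finite_subset by blast
qed

section \<open>Backward orbits under an increasing self-map\<close>

lemma funpow_in_invariant:
  assumes "G ` J \<subseteq> J" "w \<in> J"
  shows "(G ^^ k) w \<in> J"
  using assms by (induction k) auto

lemma strict_mono_on_funpow:
  fixes G :: "'a::linorder \<Rightarrow> 'a"
  assumes "strict_mono_on J G" "G ` J \<subseteq> J"
  shows "strict_mono_on J (G ^^ k)"
proof (induction k)
  case (Suc k)
  then show ?case
    using assms funpow_in_invariant[OF assms(2)] by (auto simp: strict_mono_on_def)
qed (simp add: strict_mono_on_def)

text \<open>Given \<open>w\<close> in this set, injectivity of \<open>h\<close> and of the iterates
  of \<open>G\<close> makes any other member either one of finitely many forward iterates of
  \<open>w\<close> or a preimage of \<open>w\<close>. As \<open>G\<close> is increasing, all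
  preimages other than \<open>w\<close> lie on one side of \<open>w\<close>, decided by comparing
  \<open>w\<close> with \<open>G w\<close>.\<close>

lemma backward_orbit_increasing_nowhere_dense:
  fixes G :: "real \<Rightarrow> real"
  assumes mono: "strict_mono_on J G" and inv: "G ` J \<subseteq> J" and h: "inj_on h J"
  shows "interior (closure {w \<in> J. \<exists>j. h ((G ^^ j) w) = z}) = {}"
proof (rule nowhere_dense_if_finite_on_one_side)
  let ?W = "{w \<in> J. \<exists>j. h ((G ^^ j) w) = z}"
  note inJ = funpow_in_invariant[OF inv]
  note less = strict_mono_on_less[OF strict_mono_on_funpow[OF mono inv]]
  note le = strict_mono_on_less_eq[OF strict_mono_on_funpow[OF mono inv]]
  note eq = strict_mono_on_eq[OF strict_mono_on_funpow[OF mono inv]]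
  fix w assume "w \<in> ?W"
  then obtain a where w: "w \<in> J" and a: "h ((G ^^ a) w) = z" by blast
  have dichotomy: "v \<in> (\<lambda>i. (G ^^ i) w) ` {..a} \<or> (\<exists>k. (G ^^ k) v = w)" if "v \<in> ?W" for v
  proof -
    from that obtain b where v: "v \<in> J" and b: "h ((G ^^ b) v) = z" by blast
    have same: "(G ^^ b) v = (G ^^ a) w"
      using a b h inJ v w by (metis inj_onD)
    show ?thesis
    proof (cases "a \<le> b")
      case True
      then have "(G ^^ a) ((G ^^ (b - a)) v) = (G ^^ a) w"
        using same by (metis comp_apply funpow_add le_add_diff_inverse)
      then show ?thesis using eq inJ v w by blast
    next
      case False
      then have "(G ^^ b) v = (G ^^ b) ((G ^^ (a - b)) w)"
        using same by (metis comp_apply funpow_add le_add_diff_inverse nat_le_linear)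
      then have "v = (G ^^ (a - b)) w" using eq inJ v w by blast
      then show ?thesis by auto
    qed
  qed
  have step: "(G ^^ k) (G v) = G ((G ^^ k) v)" for k v
    by (simp add: funpow_swap1)
  have Gv: "G v \<in> J" if "v \<in> J" for v using inv that by blast
  show "finite (?W \<inter> {w<..}) \<or> finite (?W \<inter> {..<w})"
  proof (cases "w \<le> G w")
    case True
    have "v \<le> w" if v: "v \<in> J" and k: "(G ^^ k) v = w" for v k
    proof -
      \<comment> \<open>Strictly increasing iterates reflect order, so \<open>w \<le> G w\<close>
        pulls back along \<open>G ^^ k\<close> to \<open>v\<close>; the orbit of \<open>v\<close>
        then ascends until it reaches \<open>w\<close>.\<close>
      have "v \<le> G v" using le[of v "G v" k] True step[of k v] k v Gv by simp
      then have "(G ^^ i) v \<le> (G ^^ Suc i) v" for i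
        using le[of v "G v" i] v Gv by (simp add: step)
      then have "(G ^^ 0) v \<le> (G ^^ k) v"
        by (rule lift_Suc_mono_le) simp
      then show ?thesis using k by simp
    qed
    then have "?W \<inter> {w<..} \<subseteq> (\<lambda>i. (G ^^ i) w) ` {..a}"
      using dichotomy by fastforce
    then show ?thesis by (meson finite_atMost finite_imageI finite_subset)
  next
    case False
    have "w \<le> v" if v: "v \<in> J" and k: "(G ^^ k) v = w" for v k
    proof -
      have "G v \<le> v" using le[of "G v" v k] False step[of k v] k v Gv by simp
      then have "(G ^^ i) v \<ge> (G ^^ Suc i) v" for i
        using le[of "G v" v i] v Gv by (simp add: step)
      then have "(G ^^ 0) v \<ge> (G ^^ k) v"
        by (rule lift_Suc_antimono_le) simp
      then show ?thesis using k by simp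
    qed
    then have "?W \<inter> {..<w} \<subseteq> (\<lambda>i. (G ^^ i) w) ` {..a}"
      using dichotomy by fastforce
    then show ?thesis by (meson finite_atMost finite_imageI finite_subset)
  qed
qed

section \<open>Points with a common digit sequence\<close>

text \<open>This is the intersection of the cylinders of all finite prefixes of
  \<open>e\<close>.\<close>

definition itinerary_set :: "('d \<Rightarrow> real set) \<Rightarrow> (real \<Rightarrow> real) \<Rightarrow> (nat \<Rightarrow> 'd) \<Rightarrow> real set" where
  "itinerary_set \<Delta> F e = {x. \<forall>i. (F ^^ i) x \<in> \<Delta> (e i)}"

lemma itinerary_set_shift:
  "x \<in> itinerary_set \<Delta> F e \<Longrightarrow> (F ^^ k) x \<in> itinerary_set \<Delta> F (\<lambda>i. e (i + k))"
  by (simp add: itinerary_set_def flip: funpow_add comp_apply[of "F ^^ _" "F ^^ _"])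

lemma nondegenerate_interval_between:
  assumes "nondegenerate_interval S" "u \<in> S" "v \<in> S" "u \<le> w" "w \<le> v"
  shows "w \<in> S"
  using assms unfolding nondegenerate_interval_def by auto

context
  fixes I :: "'d set" and \<Delta> :: "'d \<Rightarrow> real set" and F :: "real \<Rightarrow> real"
  assumes pim: "piecewise_interval_map I \<Delta> F"
begin

lemma digit_unique: "d \<in> I \<Longrightarrow> d' \<in> I \<Longrightarrow> x \<in> \<Delta> d \<Longrightarrow> x \<in> \<Delta> d' \<Longrightarrow> d = d'"
  using pim unfolding piecewise_interval_map_def interval_partition_def disjoint_family_on_def
  by blast

lemma F_representation_digit:
  assumes "x \<in> forward_domain (\<Union>d\<in>I. \<Delta> d) F"
  shows "F_representation I \<Delta> F x n \<in> I" "(F ^^ n) x \<in> \<Delta> (F_representation I \<Delta> F x n)"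
proof -
  have "\<exists>!d. d \<in> I \<and> (F ^^ n) x \<in> \<Delta> d"
    using assms digit_unique unfolding forward_domain_def by blast
  from theI'[OF this] show "F_representation I \<Delta> F x n \<in> I"
      "(F ^^ n) x \<in> \<Delta> (F_representation I \<Delta> F x n)"
    unfolding F_representation_def by auto
qed

lemma itinerary_unique:
  assumes "range e \<subseteq> I" "range e' \<subseteq> I" "x \<in> itinerary_set \<Delta> F e" "x \<in> itinerary_set \<Delta> F e'"
  shows "e = e'"
proof
  fix i
  have "e i \<in> I" "e' i \<in> I" "(F ^^ i) x \<in> \<Delta> (e i)" "(F ^^ i) x \<in> \<Delta> (e' i)"
    using assms unfolding itinerary_set_def by auto
  then show "e i = e' i" by (rule digit_unique)
qed

text \<open>Every prefix of \<open>e\<close> has a cylinder containing \<open>u\<close>; being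
  nonempty, it is an interval by the third condition on a PIM.\<close>

lemma itinerary_set_between:
  assumes e: "range e \<subseteq> I" and uv: "u \<in> itinerary_set \<Delta> F e" "v \<in> itinerary_set \<Delta> F e"
    and w: "u \<le> w" "w \<le> v"
  shows "w \<in> itinerary_set \<Delta> F e"
  unfolding itinerary_set_def
proof (intro CollectI allI)
  fix n
  \<comment> \<open>A prefix of length \<open>Suc n\<close> is the shortest that includes the digit
    at position \<open>n\<close>.\<close>
  let ?ds = "map e [0..<Suc n]"
  have uv': "u \<in> cylinder \<Delta> F ?ds" "v \<in> cylinder \<Delta> F ?ds"
    using uv unfolding cylinder_def itinerary_set_def by (auto simp del: upt_Suc)
  moreover have "?ds \<noteq> []" "set ?ds \<subseteq> I"
    using e by auto
  ultimately have "nondegenerate_interval (cylinder \<Delta> F ?ds)"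
    using pim unfolding piecewise_interval_map_def by blast
  then have "w \<in> cylinder \<Delta> F ?ds"
    using uv' w nondegenerate_interval_between by blast
  then show "(F ^^ n) w \<in> \<Delta> (e n)"
    unfolding cylinder_def by (auto simp del: upt_Suc dest!: spec[of _ n])
qed

text \<open>At each time all points of the set lie in the same branch, so the iterate is a
  composition of strictly monotone maps, even for mixed type.\<close>

lemma funpow_strict_mono_or_antimono:
  assumes e: "range e \<subseteq> I"
  shows "strict_mono_on (itinerary_set \<Delta> F e) (F ^^ k) \<or>
         strict_antimono_on (itinerary_set \<Delta> F e) (F ^^ k)"
proof (induction k)
  case 0
  then show ?case by (simp add: monotone_on_def)
next
  case (Suc k)
  have "e k \<in> I" using e by auto
  then have "strict_mono_on (\<Delta> (e k)) F \<or> strict_antimono_on (\<Delta> (e k)) F"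
    using pim unfolding piecewise_interval_map_def by blast
  moreover have "\<And>x. x \<in> itinerary_set \<Delta> F e \<Longrightarrow> (F ^^ k) x \<in> \<Delta> (e k)"
    by (simp add: itinerary_set_def)
  ultimately show ?case
    using Suc by (simp add: monotone_on_def) meson
qed

lemma inj_on_funpow_itinerary_set:
  assumes "range e \<subseteq> I"
  shows "inj_on (F ^^ k) (itinerary_set \<Delta> F e)"
  using funpow_strict_mono_or_antimono[OF assms, of k]
  by (auto simp: strict_mono_on_imp_inj_on monotone_on_def inj_on_def)
     (metis linorder_neq_iff)+

text \<open>\<open>F ^^ p\<close> may be decreasing, but its square is increasing; invariance keeps
  the inner value in the set where the monotonicity is known.\<close>

lemma strict_mono_on_funpow_double:
  assumes e: "range e \<subseteq> I" and inv: "(F ^^ p) ` itinerary_set \<Delta> F e \<subseteq> itinerary_set \<Delta> F e"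
  shows "strict_mono_on (itinerary_set \<Delta> F e) (F ^^ (p + p))"
  using funpow_strict_mono_or_antimono[OF e, of p] inv
  by (auto simp: monotone_on_def funpow_add image_subset_iff)

text \<open>Sorting \<open>k\<close> by its remainder \<open>r\<close> modulo \<open>p + p\<close>
  leaves finitely many instances of the increasing case, with \<open>G = F ^^ (p + p)\<close> and
  \<open>h = F ^^ r\<close>.\<close>

lemma backward_orbit_in_periodic_nowhere_dense:
  assumes e: "range e \<subseteq> I" and "p > 0"
    and inv: "(F ^^ p) ` itinerary_set \<Delta> F e \<subseteq> itinerary_set \<Delta> F e"
  shows "interior (closure {w \<in> itinerary_set \<Delta> F e. \<exists>k. (F ^^ k) w = z}) = {}"
proof -
  let ?J = "itinerary_set \<Delta> F e"
  let ?q = "p + p"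
  let ?V = "\<lambda>r. {w \<in> ?J. \<exists>j. (F ^^ r) (((F ^^ ?q) ^^ j) w) = z}"
  have inv2: "(F ^^ ?q) ` ?J \<subseteq> ?J"
    using inv by (auto simp: funpow_add)
  have "{w \<in> ?J. \<exists>k. (F ^^ k) w = z} \<subseteq> (\<Union>r\<in>{..<?q}. ?V r)"
  proof
    fix w assume "w \<in> {w \<in> ?J. \<exists>k. (F ^^ k) w = z}"
    then obtain k where w: "w \<in> ?J" and k: "(F ^^ k) w = z" by blast
    have "(F ^^ (k mod ?q)) (((F ^^ ?q) ^^ (k div ?q)) w) = (F ^^ (k mod ?q + ?q * (k div ?q))) w"
      by (simp only: funpow_add[of "k mod ?q" "?q * (k div ?q)"] funpow_mult comp_apply)
    also have "\<dots> = z"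
      using k by (simp only: mod_mult_div_eq)
    finally have "w \<in> ?V (k mod ?q)"
      using w by blast
    moreover have "k mod ?q < ?q" using \<open>p > 0\<close> by simp
    ultimately show "w \<in> (\<Union>r\<in>{..<?q}. ?V r)" by blast
  qed
  moreover have "interior (closure (\<Union>r\<in>{..<?q}. ?V r)) = {}"
    by (intro finite_UN_nowhere_dense finite_lessThan backward_orbit_increasing_nowhere_dense
        strict_mono_on_funpow_double[OF e inv] inv2 inj_on_funpow_itinerary_set e)
  ultimately show ?thesis
    by (metis (no_types, lifting) closure_mono interior_mono subset_empty)
qed

section \<open>Transitivity separates points with equal digits\<close>

lemma itinerary_set_subsingleton:
  assumes ptt: "parry_topologically_transitive (\<Union>d\<in>I. \<Delta> d) F"
    and e: "range e \<subseteq> I" and xy: "x \<in> itinerary_set \<Delta> F e" "y \<in> itinerary_set \<Delta> F e"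
  shows "x = y"
proof (rule ccontr)
  assume "x \<noteq> y"
  let ?C = "itinerary_set \<Delta> F"
  obtain z where dense: "{0..<1} \<subseteq> closure (backward_orbit (\<Union>d\<in>I. \<Delta> d) F z)"
    using ptt unfolding parry_topologically_transitive_def by blast
  \<comment> \<open>Dropping the definedness conditions only enlarges the backward orbit, so density
    survives.\<close>
  let ?O = "{w. \<exists>k. (F ^^ k) w = z}"
  have "backward_orbit (\<Union>d\<in>I. \<Delta> d) F z \<subseteq> ?O"
    unfolding backward_orbit_def by auto
  then have dense': "{0..<1} \<subseteq> closure ?O"
    using dense closure_mono by blast
  have unit: "?C f \<subseteq> {0..<1}" if "range f \<subseteq> I" for f
  proof
    fix w assume "w \<in> ?C f"
    then have "(F ^^ 0) w \<in> \<Delta> (f 0)" unfolding itinerary_set_def by blast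
    moreover have "f 0 \<in> I" using that by auto
    then have "\<Delta> (f 0) \<subseteq> {0..<1}"
      using pim unfolding piecewise_interval_map_def interval_partition_def by simp
    ultimately show "w \<in> {0..<1}" by auto
  qed
  have closure_part: "{a<..<b} \<subseteq> closure {w \<in> ?C f. \<exists>k. (F ^^ k) w = z}"
    if "range f \<subseteq> I" "a \<in> ?C f" "b \<in> ?C f" for f a b
  proof -
    have sub: "{a<..<b} \<subseteq> ?C f"
      using itinerary_set_between[OF that] by auto
    then have "{a<..<b} \<subseteq> {a<..<b} \<inter> closure ?O"
      using unit[OF that(1)] dense' by blast
    also have "\<dots> \<subseteq> closure ({a<..<b} \<inter> ?O)"
      by (rule open_Int_closure_subset) simp
    also have "\<dots> \<subseteq> closure {w \<in> ?C f. \<exists>k. (F ^^ k) w = z}"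
      using sub by (intro closure_mono) auto
    finally show ?thesis .
  qed
  have nontrivial: "\<exists>a b. a < b \<and> a \<in> S \<and> b \<in> S" if "s \<in> S" "t \<in> S" "s \<noteq> t"
    for S and s t :: real
    using that by (cases s t rule: linorder_cases) auto
  obtain a b where ab: "a < b" "a \<in> ?C e" "b \<in> ?C e"
    using nontrivial[OF xy \<open>x \<noteq> y\<close>] by blast
  have infinite_part: "infinite {w \<in> ?C e. \<exists>k. (F ^^ k) w = z}"
  proof
    assume fin: "finite {w \<in> ?C e. \<exists>k. (F ^^ k) w = z}"
    then have "{a<..<b} \<subseteq> {w \<in> ?C e. \<exists>k. (F ^^ k) w = z}"
      using closure_part[OF e ab(2,3)] by (simp only: closure_closed finite_imp_closed)
    then show False using fin ab(1) by (meson finite_subset infinite_Ioo)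
  qed
  obtain w1 where w1: "w1 \<in> ?C e" "\<exists>k. (F ^^ k) w1 = z"
    using infinite_imp_nonempty[OF infinite_part] by blast
  have "infinite ({w \<in> ?C e. \<exists>k. (F ^^ k) w = z} - {w1})"
    using infinite_part by simp
  then obtain w2 where w2: "w2 \<in> ?C e" "\<exists>k. (F ^^ k) w2 = z" "w1 \<noteq> w2"
    using infinite_imp_nonempty by blast
  obtain n' m' where "(F ^^ n') w1 = z" "(F ^^ m') w2 = z"
    using w1 w2 by blast
  \<comment> \<open>At a common level, injectivity of the iterate would identify \<open>w1\<close>
    and \<open>w2\<close>.\<close>
  moreover from this have "n' \<noteq> m'"
    using inj_on_funpow_itinerary_set[OF e, of m'] w1 w2 by (auto dest: inj_onD)
  ultimately obtain n m u v where nm: "n < m" "u \<in> ?C e" "v \<in> ?C e" "(F ^^ n) u = z" "(F ^^ m) v = z"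
    using w1(1) w2(1) by (cases n' m' rule: linorder_cases) blast+
  let ?f = "\<lambda>i. e (i + n)"
  define p where "p = m - n"
  have f: "range ?f \<subseteq> I" and g: "range (\<lambda>i. e (i + m)) \<subseteq> I" using e by auto
  have zf: "z \<in> ?C ?f" and zg: "z \<in> ?C (\<lambda>i. e (i + m))"
    using itinerary_set_shift[OF nm(2), of n] itinerary_set_shift[OF nm(3), of m] nm by simp_all
  \<comment> \<open>The single point \<open>z\<close> carries both shifted sequences, and its digits
    are unique; hence \<open>?f\<close> has period \<open>p\<close>.\<close>
  have "?f = (\<lambda>i. e (i + m))"
    by (rule itinerary_unique[OF f g zf zg])
  moreover have "i + p + n = i + m" for i
    using nm(1) by (simp add: p_def)
  ultimately have "(\<lambda>i. ?f (i + p)) = ?f" by (simp only:)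
  then have inv: "(F ^^ p) ` ?C ?f \<subseteq> ?C ?f"
    using itinerary_set_shift[of _ \<Delta> F ?f p] by auto
  \<comment> \<open>Injectivity of \<open>F ^^ n\<close> carries two distinct points over to the
    periodic sequence, so its set contains an open interval as well.\<close>
  have "(F ^^ n) x \<noteq> (F ^^ n) y"
    using inj_on_funpow_itinerary_set[OF e, of n] xy \<open>x \<noteq> y\<close> by (auto dest: inj_onD)
  then obtain a' b' where ab': "a' < b'" "a' \<in> ?C ?f" "b' \<in> ?C ?f"
    using nontrivial[OF itinerary_set_shift[OF xy(1)] itinerary_set_shift[OF xy(2)]] by blast
  have "{a'<..<b'} \<subseteq> interior (closure {w \<in> ?C ?f. \<exists>k. (F ^^ k) w = z})"
    by (intro interior_maximal closure_part f ab' open_greaterThanLessThan)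
  moreover have "p > 0" using nm(1) by (simp add: p_def)
  ultimately have "{a'<..<b'} \<subseteq> {}"
    using backward_orbit_in_periodic_nowhere_dense[OF f _ inv] by blast
  then show False using ab'(1) by simp
qed

end

theorem theorem9:
  fixes I :: "'d set" and \<Delta> :: "'d \<Rightarrow> real set" and F :: "real \<Rightarrow> real"
  assumes "piecewise_interval_map I \<Delta> F"
    and "parry_topologically_transitive (\<Union>d\<in>I. \<Delta> d) F"
  shows "valid_representations I \<Delta> F"
proof -
  \<comment> \<open>The set difference matches the definition of validity, with the empty set as the
    exceptional null set.\<close>
  have "inj_on (F_representation I \<Delta> F) (forward_domain (\<Union>d\<in>I. \<Delta> d) F - {})"
  proof (rule inj_onI)
    fix x y
    assume x: "x \<in> forward_domain (\<Union>d\<in>I. \<Delta> d) F - {}"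
      and y: "y \<in> forward_domain (\<Union>d\<in>I. \<Delta> d) F - {}"
      and same: "F_representation I \<Delta> F x = F_representation I \<Delta> F y"
    let ?e = "F_representation I \<Delta> F x"
    have "range ?e \<subseteq> I" "x \<in> itinerary_set \<Delta> F ?e"
      using F_representation_digit[OF assms(1)] x unfolding itinerary_set_def by auto
    moreover have "y \<in> itinerary_set \<Delta> F ?e"
      using F_representation_digit[OF assms(1)] y unfolding same itinerary_set_def by auto
    ultimately show "x = y"
      by (rule itinerary_set_subsingleton[OF assms])
  qed
  then show ?thesis
    unfolding valid_representations_def by blast
qed

end
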